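(* Let $X=\{X_n,n\ge0\}$ be a time-homogeneous Markov chain on $\mathbb{R}^+$ with jumps $\xi(x)$ and jump moments $m_1(x)$, $m_2(x)$. Assume that, for some $x_0$ and $\varepsilon>0$, $$\frac{2x\,m_1(x)}{m_2(x)}\ge1+\varepsilon\qquad\text{for all }x\ge x_0 .$$ In addition, let $$\mathbb{P}\bigl\{\limsup_{n\to\infty}X_n=\infty\bigr\}=1$$ and, for some $\gamma$ with $0<\gamma<1-1/\sqrt{1+\varepsilon}$, $$\mathbb{P}\{\xi(x)\le-\gamma x\}=o\Bigl(\frac{m_2(x)}{x}\,p(x)\Bigr)\qquad\text{as }x\to\infty,$$ where $p$ is a non-increasing integrable function. Then $X_n\to\infty$ as $n\to\infty$ with probability $1$, so that $X_n$ is transient.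
   Context: $\xi(x)$ denotes a random variable distributed as the jump of the chain from the state $x\in\mathbb{R}^+$, i.e. $\mathbb{P}\{\xi(x)\in D\}=\mathbb{P}\{X_{n+1}-X_n\in D\mid X_n=x\}$ for Borel $D$; $m_k(x):=\mathbb{E}\xi^k(x)$, with second moments finite. The function $p$ is a non-increasing function on $\mathbb{R}^+$, integrable over $\mathbb{R}^+$. *)

theory Defs
  imports "HOL-Probability.Probability" "HOL-Library.Landau_Symbols"
begin

definition history :: "'w measure \<Rightarrow> 'a measure \<Rightarrow> (nat \<Rightarrow> 'w \<Rightarrow> 'a) \<Rightarrow> nat \<Rightarrow> 'w measure" where
  "history M S X n = vimage_algebra (space M) (\<lambda>\<omega>. \<lambda>i\<in>{..n}. X i \<omega>) (Pi\<^sub>M {..n} (\<lambda>_. S))"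

text \<open>
  A time-homogeneous Markov chain with state space \<open>S\<close>, transition kernel \<open>K\<close> and arbitrary
  initial distribution. The kernel is part of the data, so that \<open>K x\<close> is a version of the law
  of \<open>X (Suc n)\<close> given \<open>X n = x\<close> that is defined for every state \<open>x\<close>.
\<close>

locale homogeneous_markov_chain = prob_space M
  for M :: "'w measure" and S :: "'a measure" and K :: "'a \<Rightarrow> 'a measure"
    and X :: "nat \<Rightarrow> 'w \<Rightarrow> 'a" +
  assumes kernel: "K \<in> S \<rightarrow>\<^sub>M prob_algebra S"
    and measurable_chain: "\<And>n. X n \<in> M \<rightarrow>\<^sub>M S"
    and markov: "\<And>n A. A \<in> sets S \<Longrightarrow>
      AE \<omega> in M. real_cond_exp M (history M S X n) (\<lambda>\<omega>. indicator A (X (Suc n) \<omega>)) \<omega>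
        = measure (K (X n \<omega>)) A"
begin

lemma subalgebra_history: "subalgebra M (history M S X n)"
proof -
  have "(\<lambda>\<omega>. \<lambda>i\<in>{..n}. X i \<omega>) \<in> M \<rightarrow>\<^sub>M Pi\<^sub>M {..n} (\<lambda>_. S)"
    using measurable_chain by (intro measurable_restrict)
  then show ?thesis
    by (auto simp: subalgebra_def history_def measurable_iff_sets)
qed

end

abbreviation nonneg_borel :: "real measure" where
  "nonneg_borel \<equiv> restrict_space borel {0..}"

text \<open>The law of the jump \<open>\<xi>(x)\<close> from the state \<open>x\<close>, and its moments \<open>m\<^sub>k(x)\<close>.\<close>

definition jump :: "(real \<Rightarrow> real measure) \<Rightarrow> real \<Rightarrow> real measure" where
  "jump K x = distr (K x) borel (\<lambda>y. y - x)"

definition jump_moment :: "(real \<Rightarrow> real measure) \<Rightarrow> nat \<Rightarrow> real \<Rightarrow> real" where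
  "jump_moment K k x = (\<integral>u. u ^ k \<partial>jump K x)"

text \<open>Transience of the chain under its given initial distribution.\<close>

definition transient :: "'w measure \<Rightarrow> (nat \<Rightarrow> 'w \<Rightarrow> 'a::metric_space) \<Rightarrow> bool" where
  "transient M X \<longleftrightarrow> (\<forall>B. bounded B \<longrightarrow> (AE \<omega> in M. finite {n. X n \<omega> \<in> B}))"

end

theory Submission
  imports Defs
begin

text \<open>
  The proof is Lyapunov's: a decreasing positive function \<open>W\<close> with \<open>W x \<rightarrow> 0\<close> as \<open>x \<rightarrow> \<infinity>\<close> that
  is superharmonic far out, \<open>E W (x + \<xi>(x)) \<le> W x\<close>, makes descents from \<open>b\<close> to \<open>a\<close> have
  probability at most \<open>W b / W a\<close> (\<open>emeasure_return_below_le\<close>). A chain that is unbounded with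
  probability one therefore returns to no bounded set infinitely often
  (\<open>filterlim_at_top_of_superharmonic\<close>).

  It remains to find \<open>W\<close>. Take \<open>W\<close> to be a mixture of the truncated powers
  \<open>min (1, (y / x)\<^sup>\<beta>)\<close>, in which \<open>y\<close> has density \<open>p\<close> and one further unit of mass sits at \<open>y = 1\<close>.
  A second order Taylor bound for \<open>(1 + t)\<^sup>-\<^sup>\<beta>\<close>, valid for every \<open>t \<ge> -\<gamma>\<close>, shows that each
  truncated power, and so \<open>W\<close>, satisfies
  \<open>W (x + u) \<le> W x + \<beta> S x (- u / x + C u\<^sup>2 / (2 x\<^sup>2))\<close> for all \<open>u \<ge> - \<gamma> x\<close>, where
  \<open>C = (1 + \<beta>) (1 - \<gamma>) powr (- \<beta> - 2)\<close> and \<open>S x\<close> is the corresponding mixture of the values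
  \<open>(y / x)\<^sup>\<beta>\<close> over \<open>y < x\<close> (\<open>ramp_mixture_le_quadratic\<close>). The condition
  \<open>\<gamma> < 1 - 1 / sqrt (1 + \<epsilon>)\<close> says that \<open>(1 - \<gamma>)\<^sup>-\<^sup>2 < 1 + \<epsilon>\<close>, so that \<open>C < 1 + \<epsilon>\<close> for small
  \<open>\<beta>\<close>. As \<open>2 x m\<^sub>1(x) \<ge> (1 + \<epsilon>) m\<^sub>2(x)\<close>, the quadratic bound contributes at most
  \<open>- \<beta> S x (1 + \<epsilon> - C) m\<^sub>2(x) / (2 x\<^sup>2)\<close> to the drift. Large negative jumps, on which the
  bound fails, contribute at most \<open>W 0\<close> times their probability, which is
  \<open>o (m\<^sub>2(x) p(x) / x)\<close>. Because \<open>p\<close> is non-increasing, \<open>S x\<close> is at least a constant multiple of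
  \<open>x p(x)\<close> (\<open>slope_mixture_ge\<close>), and so the negative term wins for large \<open>x\<close>
  (\<open>ramp_mixture_superharmonic\<close>).
\<close>

section \<open>A transience criterion\<close>

context homogeneous_markov_chain
begin

lemma measurable_history:
  assumes "i \<le> n"
  shows "X i \<in> history M S X n \<rightarrow>\<^sub>M S"
proof -
  have "(\<lambda>\<omega>. \<lambda>i\<in>{..n}. X i \<omega>) \<in> space M \<rightarrow> space (Pi\<^sub>M {..n} (\<lambda>_. S))"
    using measurable_chain by (auto intro!: measurable_space[OF measurable_restrict])
  then have "(\<lambda>\<omega>. \<lambda>i\<in>{..n}. X i \<omega>) \<in> history M S X n \<rightarrow>\<^sub>M Pi\<^sub>M {..n} (\<lambda>_. S)"
    unfolding history_def by (rule measurable_vimage_algebra1)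
  from measurable_compose[OF this measurable_component_singleton[of i "{..n}" "\<lambda>_. S"]] assms
  show ?thesis
    by simp
qed

text \<open>
  Integrating the defining identity of the conditional expectation over a past event turns the
  Markov property into an equality of measures, which then extends to integrands.
\<close>

lemma emeasure_next_inter:
  assumes E: "E \<in> sets (history M S X n)" and A[measurable]: "A \<in> sets S"
  shows "emeasure M (E \<inter> X (Suc n) -` A \<inter> space M)
    = (\<integral>\<^sup>+\<omega>. emeasure (K (X n \<omega>)) A * indicator E \<omega> \<partial>M)"
proof -
  note [measurable] = measurable_chain kernel
  interpret finite_measure_subalgebra M "history M S X n"
    by unfold_locales (rule subalgebra_history)
  have [measurable]: "E \<in> sets M"
    using E subalgebra_history by (auto simp: subalgebra_def)
  have K: "prob_space (K (X n \<omega>))" if "\<omega> \<in> space M" for \<omega>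
    using measurable_space[OF kernel measurable_space[OF measurable_chain that]]
    by (simp add: space_prob_algebra)
  have K_meas[measurable]: "(\<lambda>\<omega>. measure (K (X n \<omega>)) A) \<in> borel_measurable M"
    by measurable
  have K_int: "integrable M (\<lambda>\<omega>. indicator E \<omega> * measure (K (X n \<omega>)) A)"
    using K by (intro integrable_const_bound[where B = 1] AE_I2)
      (auto simp: indicator_def intro: prob_space.prob_le_1)
  have "measure M (E \<inter> X (Suc n) -` A \<inter> space M)
      = (\<integral>\<omega>\<in>E. indicator A (X (Suc n) \<omega>) \<partial>M)"
  proof -
    have "E \<inter> X (Suc n) -` A \<inter> space M \<in> sets M"
      using measurable_sets[OF measurable_chain A, of "Suc n"] \<open>E \<in> sets M\<close>
      by (metis inf_assoc sets.Int)
    then have "measure M (E \<inter> X (Suc n) -` A \<inter> space M)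
      = (\<integral>\<omega>. indicator (E \<inter> X (Suc n) -` A \<inter> space M) \<omega> \<partial>M)"
      by simp
    also have "\<dots> = (\<integral>\<omega>\<in>E. indicator A (X (Suc n) \<omega>) \<partial>M)"
      unfolding set_lebesgue_integral_def
      by (rule Bochner_Integration.integral_cong) (auto simp: indicator_def)
    finally show ?thesis .
  qed
  also have "\<dots> = (\<integral>\<omega>\<in>E. real_cond_exp M (history M S X n)
      (\<lambda>\<omega>. indicator A (X (Suc n) \<omega>)) \<omega> \<partial>M)"
    by (rule real_cond_exp_intA[OF _ E])
      (auto intro!: integrable_const_bound[where B = 1] AE_I2 simp: indicator_def)
  also have "\<dots> = (\<integral>\<omega>. indicator E \<omega> * measure (K (X n \<omega>)) A \<partial>M)"
    unfolding set_lebesgue_integral_def using markov[OF A, of n]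
    by (intro integral_cong_AE) auto
  finally have "emeasure M (E \<inter> X (Suc n) -` A \<inter> space M)
      = ennreal (\<integral>\<omega>. indicator E \<omega> * measure (K (X n \<omega>)) A \<partial>M)"
    by (simp add: emeasure_eq_measure)
  also have "\<dots> = (\<integral>\<^sup>+\<omega>. ennreal (indicator E \<omega> * measure (K (X n \<omega>)) A) \<partial>M)"
    using K_int by (subst nn_integral_eq_integral) auto
  also have "\<dots> = (\<integral>\<^sup>+\<omega>. emeasure (K (X n \<omega>)) A * indicator E \<omega> \<partial>M)"
    using K by (intro nn_integral_cong)
      (auto simp: indicator_def finite_measure.emeasure_eq_measure prob_space_def)
  finally show ?thesis .
qed

lemma nn_integral_next:
  assumes E: "E \<in> sets (history M S X n)" and f[measurable]: "f \<in> borel_measurable S"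
  shows "(\<integral>\<^sup>+\<omega>. f (X (Suc n) \<omega>) * indicator E \<omega> \<partial>M)
    = (\<integral>\<^sup>+\<omega>. (\<integral>\<^sup>+y. f y \<partial>K (X n \<omega>)) * indicator E \<omega> \<partial>M)"
proof -
  note [measurable] = measurable_chain kernel
  have [measurable]: "E \<in> sets M"
    using E subalgebra_history by (auto simp: subalgebra_def)
  have K[measurable]: "K \<in> S \<rightarrow>\<^sub>M subprob_algebra S"
    using kernel by (rule measurable_prob_algebraD)
  have setsK: "sets (K x) = sets S" if "x \<in> space S" for x
    using measurable_space[OF kernel that] by (simp add: space_prob_algebra)
  have ne: "space S \<noteq> {}"
    using measurable_space[OF measurable_chain] not_empty by fastforce
  define N where "N = density M (indicator E)"
  have N: "(\<integral>\<^sup>+\<omega>. g \<omega> \<partial>N) = (\<integral>\<^sup>+\<omega>. g \<omega> * indicator E \<omega> \<partial>M)"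
    if [measurable]: "g \<in> borel_measurable M" for g
    unfolding N_def by (subst nn_integral_density) (auto simp: mult.commute)
  have NM[measurable]: "h \<in> N \<rightarrow>\<^sub>M S" if "h \<in> M \<rightarrow>\<^sub>M S" for h
    using that by (simp add: N_def)
  have "distr N S (X (Suc n)) = distr N S (X n) \<bind> K"
  proof (rule measure_eqI)
    show "sets (distr N S (X (Suc n))) = sets (distr N S (X n) \<bind> K)"
      using setsK ne by (subst sets_bind[where N = S]) auto
    fix A assume "A \<in> sets (distr N S (X (Suc n)))"
    then have A[measurable]: "A \<in> sets S"
      by simp
    have "emeasure (distr N S (X (Suc n))) A = emeasure N (X (Suc n) -` A \<inter> space N)"
      by (rule emeasure_distr) (auto intro: NM measurable_chain)
    also have "\<dots> = emeasure M (E \<inter> X (Suc n) -` A \<inter> space M)"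
      unfolding N_def by (subst emeasure_density)
       (auto simp: indicator_inter_arith[symmetric] Int_assoc intro!: measurable_sets[OF measurable_chain])
    also have "\<dots> = (\<integral>\<^sup>+\<omega>. emeasure (K (X n \<omega>)) A \<partial>N)"
      by (simp add: emeasure_next_inter[OF E A] N)
    also have "\<dots> = (\<integral>\<^sup>+x. emeasure (K x) A \<partial>distr N S (X n))"
      by (rule nn_integral_distr[symmetric]) (auto intro: NM measurable_chain)
    also have "\<dots> = emeasure (distr N S (X n) \<bind> K) A"
      using ne by (subst emeasure_bind[where N = S]) auto
    finally show "emeasure (distr N S (X (Suc n))) A = emeasure (distr N S (X n) \<bind> K) A" .
  qed
  then have "(\<integral>\<^sup>+y. f y \<partial>distr N S (X (Suc n))) = (\<integral>\<^sup>+x. \<integral>\<^sup>+y. f y \<partial>K x \<partial>distr N S (X n))"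
    by (simp add: nn_integral_bind[where B = S])
  then show ?thesis
    by (simp add: nn_integral_distr NM measurable_chain N)
qed

end

lemma borel_measurable_antimono:
  fixes W :: "real \<Rightarrow> real"
  assumes "antimono W"
  shows "W \<in> borel_measurable borel"
proof -
  have "(\<lambda>x. - W x) \<in> borel_measurable borel"
    using assms by (intro borel_measurable_mono) (auto simp: mono_def antimono_def)
  from borel_measurable_uminus[OF this] show ?thesis by simp
qed

text \<open>
  This is the maximal inequality for the supermartingale \<open>W (X n)\<close>, started when the chain
  first reaches \<open>[b, \<infinity>)\<close> and stopped when it then first falls to \<open>a\<close> or below: it starts with
  value at most \<open>W b\<close> and, since \<open>W\<close> decreases, is stopped with value at least \<open>W a\<close>. To avoid
  stopping times, the proof follows the process \<open>Z\<close> that is frozen at \<open>W b\<close> before the start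
  and at \<open>W a\<close> after the fall.
\<close>

lemma emeasure_return_below_le:
  fixes W :: "real \<Rightarrow> real"
  assumes "homogeneous_markov_chain M nonneg_borel K X"
    and anti: "antimono W" and pos: "\<And>x. 0 < W x"
    and super: "\<And>x. a < x \<Longrightarrow> 0 \<le> x \<Longrightarrow> (\<integral>\<^sup>+y. W y \<partial>K x) \<le> W x"
    and "a < b"
  shows "W a * emeasure M {\<omega> \<in> space M. \<exists>k j. k \<le> j \<and> b \<le> X k \<omega> \<and> X j \<omega> \<le> a} \<le> W b"
proof -
  interpret homogeneous_markov_chain M nonneg_borel K X by fact
  have XM[measurable]: "X n \<in> borel_measurable M" for n
    using measurable_chain[of n] by (simp add: measurable_restrict_space2_iff)
  have Xnn: "0 \<le> X n \<omega>" if "\<omega> \<in> space M" for n \<omega>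
    using measurable_space[OF measurable_chain that] by simp
  have [measurable]: "W \<in> borel_measurable borel"
    using anti by (rule borel_measurable_antimono)
  \<comment> \<open>\<open>H n\<close>: the chain is started by time \<open>n\<close>; \<open>D n\<close>: it has fallen by time \<open>n\<close>.\<close>
  define H where "H n = {\<omega> \<in> space M. \<exists>k\<le>n. b \<le> X k \<omega>}" for n
  define D where "D n = {\<omega> \<in> space M. \<exists>j\<le>n. \<exists>k\<le>j. b \<le> X k \<omega> \<and> X j \<omega> \<le> a}" for n
  have [measurable]: "H n \<in> sets M" "D n \<in> sets M" for n
    unfolding H_def D_def by measurable
  have hist: "H n - D n \<in> sets (history M nonneg_borel X n)" for n
  proof -
    have sp: "space (history M nonneg_borel X n) = space M"
      by (simp add: history_def)
    have Xh: "X i \<in> borel_measurable (history M nonneg_borel X n)" if "i \<le> n" for i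
      using measurable_history[OF that] by (simp add: measurable_restrict_space2_iff)
    have "{\<omega> \<in> space (history M nonneg_borel X n). b \<le> X i \<omega>} \<in> sets (history M nonneg_borel X n)"
      "{\<omega> \<in> space (history M nonneg_borel X n). X i \<omega> \<le> a} \<in> sets (history M nonneg_borel X n)"
      if "i \<le> n" for i
      using Xh[OF that] by measurable
    then have "{\<omega> \<in> space (history M nonneg_borel X n). \<exists>k\<in>{..n}. b \<le> X k \<omega>}
        - {\<omega> \<in> space (history M nonneg_borel X n). \<exists>j\<in>{..n}. \<exists>k\<in>{..j}. b \<le> X k \<omega> \<and> X j \<omega> \<le> a}
      \<in> sets (history M nonneg_borel X n)"
      by (intro sets.Diff sets.sets_Collect_finite_Ex sets.sets_Collect_conj) auto
    then show ?thesis
      by (simp only: H_def D_def sp Bex_def atMost_iff)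
  qed
  \<comment> \<open>\<open>R\<close> collects the frozen values, so that only the last term of \<open>Z\<close> moves in one step.\<close>
  define R :: "nat \<Rightarrow> 'a \<Rightarrow> ennreal"
    where "R n \<omega> = ennreal (W b) * indicator (space M - H n) \<omega> + ennreal (W a) * indicator (D n) \<omega>" for n \<omega>
  define Z where "Z n \<omega> = R n \<omega> + ennreal (W (X n \<omega>)) * indicator (H n - D n) \<omega>" for n \<omega>
  have [measurable]: "R n \<in> borel_measurable M" "Z n \<in> borel_measurable M" for n
    unfolding R_def Z_def by measurable
  have step: "(\<integral>\<^sup>+\<omega>. Z (Suc n) \<omega> \<partial>M) \<le> (\<integral>\<^sup>+\<omega>. Z n \<omega> \<partial>M)" for n
  proof -
    have "Z (Suc n) \<omega> \<le> R n \<omega> + ennreal (W (X (Suc n) \<omega>)) * indicator (H n - D n) \<omega>"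
      if "\<omega> \<in> space M" for \<omega>
    proof -
      have HS: "\<omega> \<in> H (Suc n) \<longleftrightarrow> \<omega> \<in> H n \<or> b \<le> X (Suc n) \<omega>"
        using that by (auto simp: H_def le_Suc_eq)
      have ex_Suc: "(\<exists>j\<le>Suc n. P j) \<longleftrightarrow> (\<exists>j\<le>n. P j) \<or> P (Suc n)" for P
        by (auto simp: le_Suc_eq)
      have DS: "\<omega> \<in> D (Suc n) \<longleftrightarrow> \<omega> \<in> D n \<or> (\<omega> \<in> H n \<and> X (Suc n) \<omega> \<le> a)"
        using that \<open>a < b\<close> by (auto simp: H_def D_def ex_Suc)
      have DH: "\<omega> \<in> D n \<Longrightarrow> \<omega> \<in> H n"
        by (auto simp: H_def D_def intro: order_trans)
      have "b \<le> X (Suc n) \<omega> \<Longrightarrow> W (X (Suc n) \<omega>) \<le> W b"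
        "X (Suc n) \<omega> \<le> a \<Longrightarrow> W a \<le> W (X (Suc n) \<omega>)"
        using anti by (auto simp: antimono_def)
      then show ?thesis
        using that HS DS DH \<open>a < b\<close>
        by (auto simp: Z_def R_def indicator_def intro: ennreal_leI)
    qed
    then have "(\<integral>\<^sup>+\<omega>. Z (Suc n) \<omega> \<partial>M)
        \<le> (\<integral>\<^sup>+\<omega>. R n \<omega> + ennreal (W (X (Suc n) \<omega>)) * indicator (H n - D n) \<omega> \<partial>M)"
      by (intro nn_integral_mono)
    also have "\<dots> = (\<integral>\<^sup>+\<omega>. R n \<omega> \<partial>M) + (\<integral>\<^sup>+\<omega>. ennreal (W (X (Suc n) \<omega>)) * indicator (H n - D n) \<omega> \<partial>M)"
      by (rule nn_integral_add) measurable
    also have "(\<integral>\<^sup>+\<omega>. ennreal (W (X (Suc n) \<omega>)) * indicator (H n - D n) \<omega> \<partial>M)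
        = (\<integral>\<^sup>+\<omega>. (\<integral>\<^sup>+y. W y \<partial>K (X n \<omega>)) * indicator (H n - D n) \<omega> \<partial>M)"
      by (rule nn_integral_next[OF hist]) (auto intro: measurable_restrict_space1)
    also have "\<dots> \<le> (\<integral>\<^sup>+\<omega>. ennreal (W (X n \<omega>)) * indicator (H n - D n) \<omega> \<partial>M)"
    proof (intro nn_integral_mono)
      fix \<omega> assume w: "\<omega> \<in> space M"
      show "(\<integral>\<^sup>+y. W y \<partial>K (X n \<omega>)) * indicator (H n - D n) \<omega>
        \<le> ennreal (W (X n \<omega>)) * indicator (H n - D n) \<omega>"
      proof (cases "\<omega> \<in> H n - D n")
        case True
        then have "a < X n \<omega>"
          by (auto simp: H_def D_def not_le[symmetric])
        with True super Xnn[OF w] show ?thesis by simp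
      qed simp
    qed
    also have "(\<integral>\<^sup>+\<omega>. R n \<omega> \<partial>M) + \<dots> = (\<integral>\<^sup>+\<omega>. Z n \<omega> \<partial>M)"
      unfolding Z_def by (rule nn_integral_add[symmetric]) measurable
    finally show ?thesis
      by (simp add: add_left_mono)
  qed
  have "(\<integral>\<^sup>+\<omega>. Z n \<omega> \<partial>M) \<le> W b" for n
  proof (induction n)
    case 0
    have "Z 0 \<omega> \<le> W b" if "\<omega> \<in> space M" for \<omega>
      using that anti \<open>a < b\<close>
      by (auto simp: Z_def R_def H_def D_def indicator_def antimono_def intro!: ennreal_leI)
    then have "(\<integral>\<^sup>+\<omega>. Z 0 \<omega> \<partial>M) \<le> (\<integral>\<^sup>+\<omega>. W b \<partial>M)"
      by (intro nn_integral_mono)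
    then show ?case
      by (simp add: emeasure_space_1)
  qed (use step order_trans in blast)
  moreover have "W a * emeasure M (D n) \<le> (\<integral>\<^sup>+\<omega>. Z n \<omega> \<partial>M)" for n
  proof -
    have "W a * emeasure M (D n) = (\<integral>\<^sup>+\<omega>. ennreal (W a) * indicator (D n) \<omega> \<partial>M)"
      by (simp add: nn_integral_cmult_indicator)
    also have "\<dots> \<le> (\<integral>\<^sup>+\<omega>. Z n \<omega> \<partial>M)"
      by (intro nn_integral_mono) (auto simp: Z_def R_def indicator_def)
    finally show ?thesis .
  qed
  ultimately have bound: "W a * emeasure M (D n) \<le> W b" for n
    using order_trans by blast
  have "(SUP n. W a * emeasure M (D n)) = W a * emeasure M (\<Union>n. D n)"
  proof -
    have "incseq D"
      by (auto simp: incseq_def D_def intro: order_trans)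
    then show ?thesis
      by (simp add: SUP_mult_left_ennreal[symmetric] SUP_emeasure_incseq image_subset_iff)
  qed
  moreover have "(\<Union>n. D n) = {\<omega> \<in> space M. \<exists>k j. k \<le> j \<and> b \<le> X k \<omega> \<and> X j \<omega> \<le> a}"
    by (auto simp: D_def)
  moreover have "(SUP n. W a * emeasure M (D n)) \<le> W b"
    by (rule SUP_least) (rule bound)
  ultimately show ?thesis
    by simp
qed

text \<open>
  A chain that is unbounded above and returns to \<open>(-\<infinity>, a]\<close> infinitely often makes a descent
  from \<open>[b, \<infinity>)\<close> to \<open>(-\<infinity>, a]\<close> for every \<open>b\<close>. Such a descent has probability at most
  \<open>W b / W a\<close>, which vanishes as \<open>b \<rightarrow> \<infinity>\<close>.
\<close>

lemma filterlim_at_top_of_superharmonic: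
  fixes W :: "real \<Rightarrow> real"
  assumes chain: "homogeneous_markov_chain M nonneg_borel K X"
    and anti: "antimono W" and pos: "\<And>x. 0 < W x" and lim: "(W \<longlongrightarrow> 0) at_top"
    and super: "\<And>x. r \<le> x \<Longrightarrow> 0 \<le> x \<Longrightarrow> (\<integral>\<^sup>+y. W y \<partial>K x) \<le> W x"
    and unbounded: "AE \<omega> in M. limsup (\<lambda>n. ereal (X n \<omega>)) = \<infinity>"
  shows "AE \<omega> in M. filterlim (\<lambda>n. X n \<omega>) at_top sequentially"
proof -
  interpret homogeneous_markov_chain M nonneg_borel K X by fact
  have XM[measurable]: "X n \<in> borel_measurable M" for n
    using measurable_chain[of n] by (simp add: measurable_restrict_space2_iff)
  define D where "D a b = {\<omega> \<in> space M. \<exists>k j. k \<le> j \<and> b \<le> X k \<omega> \<and> X j \<omega> \<le> a}" for a b :: real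
  have [measurable]: "D a b \<in> sets M" for a b
    unfolding D_def by measurable
  have AE_not_D: "AE \<omega> in M. \<exists>b::nat. \<omega> \<notin> D a b" if "r \<le> a" for a
  proof -
    have "W a * measure M (\<Inter>b::nat. D a b) \<le> W b" if "a < b" for b
    proof -
      have "(\<Inter>b::nat. D a b) \<subseteq> D a b"
      proof
        fix \<omega> assume \<omega>: "\<omega> \<in> (\<Inter>n::nat. D a n)"
        obtain n :: nat where "b \<le> n"
          using real_arch_simple by blast
        moreover have "\<omega> \<in> D a n"
          using \<omega> by blast
        ultimately show "\<omega> \<in> D a b"
          unfolding D_def by (auto intro: order_trans)
      qed
      then have "W a * emeasure M (\<Inter>b::nat. D a b) \<le> W a * emeasure M (D a b)"
        by (intro mult_left_mono emeasure_mono) auto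
      also have "\<dots> \<le> W b"
        unfolding D_def using \<open>r \<le> a\<close> that
        by (intro emeasure_return_below_le[OF chain anti pos super]) auto
      finally show ?thesis
        using pos[of a] pos[of b] by (simp add: emeasure_eq_measure ennreal_mult[symmetric])
    qed
    then have "W a * measure M (\<Inter>b::nat. D a b) \<le> 0"
      by (intro tendsto_lowerbound[OF lim] eventually_mono[OF eventually_gt_at_top[of a]]) auto
    then have "measure M (\<Inter>b::nat. D a b) = 0"
      using pos[of a] measure_nonneg[of M "\<Inter>b::nat. D a b"] by (simp add: mult_le_0_iff)
    then have "(\<Inter>b::nat. D a b) \<in> null_sets M"
      by (intro null_setsI) (auto simp: emeasure_eq_measure)
    from AE_not_in[OF this] show ?thesis by simp
  qed
  then have "AE \<omega> in M. \<forall>i::nat. \<exists>b::nat. \<omega> \<notin> D (max r i) b"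
    by (simp add: AE_all_countable)
  with unbounded AE_space show ?thesis
  proof eventually_elim
    case (elim \<omega>)
    have "\<forall>\<^sub>F n in sequentially. c \<le> X n \<omega>" for c
    proof -
      obtain i :: nat where i: "c \<le> i"
        using real_arch_simple by blast
      obtain b :: nat where b: "\<omega> \<notin> D (max r i) b"
        using elim by blast
      have "\<exists>k. real b \<le> X k \<omega>"
      proof (rule ccontr)
        assume "\<not> ?thesis"
        then have "limsup (\<lambda>n. ereal (X n \<omega>)) \<le> ereal b"
          by (intro Limsup_bounded always_eventually) (auto simp: not_le intro: less_imp_le)
        with elim show False by simp
      qed
      then obtain k where k: "real b \<le> X k \<omega>" ..
      have "c \<le> X j \<omega>" if "k \<le> j" for j
      proof (rule ccontr)
        assume "\<not> c \<le> X j \<omega>"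
        then have "X j \<omega> \<le> max r i"
          using i by simp
        with k that elim(2) have "\<omega> \<in> D (max r i) b"
          unfolding D_def by blast
        with b show False ..
      qed
      then show ?thesis
        by (auto simp: eventually_sequentially)
    qed
    then show ?case
      by (simp add: filterlim_at_top)
  qed
qed

lemma transient_of_filterlim_at_top:
  fixes X :: "nat \<Rightarrow> 'w \<Rightarrow> real"
  assumes "AE \<omega> in M. filterlim (\<lambda>n. X n \<omega>) at_top sequentially"
  shows "transient M X"
  unfolding transient_def
proof (intro allI impI)
  fix B :: "real set" assume "bounded B"
  then obtain c where c: "\<And>x. x \<in> B \<Longrightarrow> x \<le> c"
    by (auto simp: bounded_iff intro: abs_le_D1)
  from assms show "AE \<omega> in M. finite {n. X n \<omega> \<in> B}"
  proof eventually_elim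
    case (elim \<omega>)
    then have "\<forall>\<^sub>F n in sequentially. c < X n \<omega>"
      by (simp add: filterlim_at_top_dense)
    then have "\<forall>\<^sub>F n in cofinite. X n \<omega> \<notin> B"
      using c by (auto simp: cofinite_eq_sequentially not_le[symmetric] elim!: eventually_mono)
    then show ?case
      by (simp add: eventually_cofinite)
  qed
qed

section \<open>Truncated powers as test functions\<close>

text \<open>
  Taylor's theorem at \<open>0\<close>: the second derivative \<open>\<beta> (\<beta> + 1) (1 + s) powr (- \<beta> - 2)\<close> decreases in
  \<open>s\<close>, so its value at \<open>- \<gamma>\<close> bounds it on the whole range.
\<close>

lemma powr_minus_le_quadratic:
  fixes \<beta> \<gamma> t :: real
  assumes "0 < \<beta>" "0 < \<gamma>" "\<gamma> < 1" "- \<gamma> \<le> t"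
  shows "(1 + t) powr - \<beta> \<le> 1 - \<beta> * t + \<beta> * ((1 + \<beta>) * (1 - \<gamma>) powr (- \<beta> - 2)) * t\<^sup>2 / 2"
proof (cases "t = 0")
  case False
  define diff :: "nat \<Rightarrow> real \<Rightarrow> real" where "diff = (\<lambda>m s.
    if m = 0 then (1 + s) powr - \<beta>
    else if m = 1 then - \<beta> * (1 + s) powr (- \<beta> - 1)
    else \<beta> * (\<beta> + 1) * (1 + s) powr (- \<beta> - 2))"
  have deriv: "\<forall>m s. m < 2 \<and> - \<gamma> \<le> s \<and> s \<le> max 0 t \<longrightarrow> (diff m has_real_derivative diff (Suc m) s) (at s)"
  proof (intro allI impI)
    fix m :: nat and s :: real
    assume "m < 2 \<and> - \<gamma> \<le> s \<and> s \<le> max 0 t"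
    then have "m = 0 \<or> m = 1" "0 < 1 + s"
      using \<open>\<gamma> < 1\<close> by auto
    then show "(diff m has_real_derivative diff (Suc m) s) (at s)"
      by (auto simp: diff_def algebra_simps intro!: derivative_eq_intros)
  qed
  from Taylor[OF _ _ deriv, of "\<lambda>s. (1 + s) powr - \<beta>" 0 t] assms False
  obtain s where s: "if t < 0 then t < s \<and> s < 0 else 0 < s \<and> s < t"
    and eq: "(1 + t) powr - \<beta> = (\<Sum>m<2. diff m 0 / fact m * t ^ m) + diff 2 s / fact 2 * t\<^sup>2"
    by (auto simp: diff_def)
  have "(1 + s) powr (- \<beta> - 2) \<le> (1 - \<gamma>) powr (- \<beta> - 2)"
    using s assms by (intro powr_mono2') (auto split: if_splits)
  then have "\<beta> * (1 + \<beta>) * (1 + s) powr (- \<beta> - 2) * t\<^sup>2 / 2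
      \<le> \<beta> * (1 + \<beta>) * (1 - \<gamma>) powr (- \<beta> - 2) * t\<^sup>2 / 2"
    using \<open>0 < \<beta>\<close> by (intro divide_right_mono mult_right_mono mult_left_mono) auto
  then show ?thesis
    unfolding eq by (simp add: diff_def numeral_2_eq_2 algebra_simps)
qed simp

text \<open>
  At \<open>\<beta> = 0\<close> the left-hand side is \<open>1 / (1 - \<gamma>)\<^sup>2\<close>, and the bound on \<open>\<gamma>\<close> makes this smaller than
  \<open>1 + \<epsilon>\<close>; continuity leaves room for a positive \<open>\<beta>\<close>.
\<close>

lemma exists_exponent:
  fixes \<gamma> \<epsilon> :: real
  assumes "0 < \<gamma>" "0 < \<epsilon>" "\<gamma> < 1 - 1 / sqrt (1 + \<epsilon>)"
  shows "\<exists>\<beta>>0. (1 + \<beta>) * (1 - \<gamma>) powr (- \<beta> - 2) < 1 + \<epsilon>"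
proof -
  have "1 / sqrt (1 + \<epsilon>) < 1 - \<gamma>"
    using assms by simp
  moreover have pos: "0 < 1 / sqrt (1 + \<epsilon>)"
    using assms by simp
  ultimately have "(1 / sqrt (1 + \<epsilon>))\<^sup>2 < (1 - \<gamma>)\<^sup>2"
    by (intro power_strict_mono) auto
  then have sq: "1 / (1 + \<epsilon>) < (1 - \<gamma>)\<^sup>2"
    using assms by (simp add: power_divide)
  have "0 < 1 - \<gamma>"
    using pos assms by linarith
  then have "(1 - \<gamma>) powr - 2 = 1 / (1 - \<gamma>)\<^sup>2"
    by (simp add: powr_minus_divide)
  also have "\<dots> < 1 + \<epsilon>"
    using sq \<open>0 < 1 - \<gamma>\<close> assms by (simp add: field_simps)
  finally have "(1 + 0) * (1 - \<gamma>) powr (- 0 - 2) < 1 + \<epsilon>"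
    by simp
  moreover have "((\<lambda>\<beta>. (1 + \<beta>) * (1 - \<gamma>) powr (- \<beta> - 2)) \<longlongrightarrow> (1 + 0) * (1 - \<gamma>) powr (- 0 - 2)) (at_right 0)"
    using \<open>0 < 1 - \<gamma>\<close> by (intro tendsto_intros) auto
  ultimately have "\<forall>\<^sub>F \<beta> in at_right 0. (1 + \<beta>) * (1 - \<gamma>) powr (- \<beta> - 2) < 1 + \<epsilon>"
    by (rule order_tendstoD(2)[rotated])
  then obtain b where "0 < b" "\<And>\<beta>. 0 < \<beta> \<Longrightarrow> \<beta> < b \<Longrightarrow> (1 + \<beta>) * (1 - \<gamma>) powr (- \<beta> - 2) < 1 + \<epsilon>"
    by (auto simp: eventually_at_right_field)
  then show ?thesis
    by (intro exI[of _ "b / 2"]) auto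
qed

definition ramp :: "real \<Rightarrow> real \<Rightarrow> real \<Rightarrow> real" where
  "ramp \<beta> y x = (if x \<le> y then 1 else (y / x) powr \<beta>)"

text \<open>Away from the kink, this is \<open>- x / \<beta>\<close> times the derivative of \<open>ramp \<beta> y\<close> at \<open>x\<close>.\<close>

definition ramp_slope :: "real \<Rightarrow> real \<Rightarrow> real \<Rightarrow> real" where
  "ramp_slope \<beta> y x = (if x \<le> y then 0 else (y / x) powr \<beta>)"

lemma ramp_nonneg: "0 \<le> ramp \<beta> y x"
  and ramp_slope_nonneg: "0 \<le> ramp_slope \<beta> y x"
  by (auto simp: ramp_def ramp_slope_def)

lemma ramp_le_1: "0 < \<beta> \<Longrightarrow> 0 \<le> y \<Longrightarrow> ramp \<beta> y x \<le> 1"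
  and ramp_slope_le_1: "0 < \<beta> \<Longrightarrow> 0 \<le> y \<Longrightarrow> ramp_slope \<beta> y x \<le> 1"
  by (auto simp: ramp_def ramp_slope_def intro!: powr_le1 simp: divide_simps)

lemma antimono_ramp:
  assumes "0 < \<beta>" "0 \<le> y"
  shows "antimono (ramp \<beta> y)"
proof (rule antimonoI)
  fix x z :: real assume "x \<le> z"
  show "ramp \<beta> y z \<le> ramp \<beta> y x"
  proof (cases "x \<le> y")
    case True
    then show ?thesis
      using ramp_le_1[OF assms] by (simp add: ramp_def)
  next
    case False
    then have "(y / z) powr \<beta> \<le> (y / x) powr \<beta>"
      using assms \<open>x \<le> z\<close> by (intro powr_mono2) (auto intro!: divide_left_mono)
    then show ?thesis
      using False \<open>x \<le> z\<close> by (simp add: ramp_def)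
  qed
qed

lemma tendsto_ramp:
  assumes "0 < \<beta>" "0 \<le> y"
  shows "(ramp \<beta> y \<longlongrightarrow> 0) at_top"
proof -
  have "((\<lambda>x. (y / x) powr \<beta>) \<longlongrightarrow> 0) at_top"
  proof (rule tendsto_zero_powrI[where b = \<beta>])
    show "((\<lambda>x. y / x) \<longlongrightarrow> 0) at_top"
      by (rule tendsto_divide_0[OF tendsto_const]) (rule filterlim_mono[OF filterlim_ident], auto simp: at_top_le_at_infinity)
  qed (use assms in \<open>auto intro!: eventually_mono[OF eventually_ge_at_top[of 0]]\<close>)
  then show ?thesis
    by (rule Lim_transform_eventually)
      (auto intro!: eventually_mono[OF eventually_gt_at_top[of y]] simp: ramp_def)
qed

text \<open>
  To the right of \<open>y\<close> this is the Taylor bound at \<open>t = u / x\<close>. To the left the right-hand side is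
  \<open>1\<close>, the maximum of the ramp; the truncation only helps, because the kink at \<open>y\<close> is concave.
\<close>

lemma ramp_le_quadratic:
  assumes "0 < \<beta>" "0 < \<gamma>" "\<gamma> < 1" "0 \<le> y" "0 < x" "- \<gamma> * x \<le> u"
  shows "ramp \<beta> y (x + u) \<le> ramp \<beta> y x
    + \<beta> * ramp_slope \<beta> y x * (- u / x + (1 + \<beta>) * (1 - \<gamma>) powr (- \<beta> - 2) * (u / x)\<^sup>2 / 2)"
proof (cases "x \<le> y")
  case True
  then show ?thesis
    using ramp_le_1[OF assms(1,4)] by (simp add: ramp_def ramp_slope_def)
next
  case False
  have t: "- \<gamma> \<le> u / x"
    using assms by (simp add: field_simps)
  then have z: "0 < 1 + u / x"
    using \<open>\<gamma> < 1\<close> by linarith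
  have "1 + u / x = (x + u) / x"
    using \<open>0 < x\<close> by (simp add: field_simps)
  with z \<open>0 < x\<close> have xu: "0 < x + u"
    by (simp add: zero_less_divide_iff)
  have "ramp \<beta> y (x + u) \<le> (y / (x + u)) powr \<beta>"
  proof (cases "x + u \<le> y")
    case True
    then have "1 \<le> (y / (x + u)) powr \<beta>"
      using xu \<open>0 < \<beta>\<close> by (intro ge_one_powr_ge_zero) auto
    with True show ?thesis by (simp add: ramp_def)
  qed (simp add: ramp_def)
  also have "y / (x + u) = (y / x) / (1 + u / x)"
    using \<open>0 < x\<close> xu by (simp add: field_simps)
  also have "\<dots> powr \<beta> = (y / x) powr \<beta> * (1 + u / x) powr - \<beta>"
    by (subst powr_divide) (use z assms in \<open>auto simp: powr_minus_divide\<close>)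
  also have "\<dots> \<le> (y / x) powr \<beta> * (1 - \<beta> * (u / x) + \<beta> * ((1 + \<beta>) * (1 - \<gamma>) powr (- \<beta> - 2)) * (u / x)\<^sup>2 / 2)"
    using assms t by (intro mult_left_mono powr_minus_le_quadratic) auto
  finally show ?thesis
    using False by (simp add: ramp_def ramp_slope_def algebra_simps)
qed

section \<open>The Lyapunov function\<close>

text \<open>
  The ramp at \<open>1\<close> is added to keep the mixture positive when \<open>f\<close> vanishes.
\<close>

definition ramp_mixture :: "real \<Rightarrow> (real \<Rightarrow> real) \<Rightarrow> real \<Rightarrow> real" where
  "ramp_mixture \<beta> f x = ramp \<beta> 1 x + (\<integral>y. f y * ramp \<beta> y x \<partial>lborel)"

definition slope_mixture :: "real \<Rightarrow> (real \<Rightarrow> real) \<Rightarrow> real \<Rightarrow> real" where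
  "slope_mixture \<beta> f x = ramp_slope \<beta> 1 x + (\<integral>y. f y * ramp_slope \<beta> y x \<partial>lborel)"

context
  fixes \<beta> :: real and f :: "real \<Rightarrow> real"
  assumes \<beta>: "0 < \<beta>"
    and f: "integrable lborel f" and f_nonneg: "\<And>y. 0 \<le> f y" and f_neg: "\<And>y. y < 0 \<Longrightarrow> f y = 0"
begin

lemma f_measurable[measurable]: "f \<in> borel_measurable borel"
  using borel_measurable_integrable[OF f] by simp

lemma integrable_mixture:
  "integrable lborel (\<lambda>y. f y * ramp \<beta> y x)"
  "integrable lborel (\<lambda>y. f y * ramp_slope \<beta> y x)"
proof -
  have "f y * ramp \<beta> y x \<le> f y" "f y * ramp_slope \<beta> y x \<le> f y" for y
    using f_neg[of y] f_nonneg[of y] ramp_le_1[OF \<beta>, of y x] ramp_slope_le_1[OF \<beta>, of y x]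
    by (cases "y < 0"; simp add: mult_left_le)+
  then show "integrable lborel (\<lambda>y. f y * ramp \<beta> y x)"
    "integrable lborel (\<lambda>y. f y * ramp_slope \<beta> y x)"
    using f_nonneg ramp_nonneg ramp_slope_nonneg
    by (auto intro!: Bochner_Integration.integrable_bound[OF f] AE_I2 simp: ramp_def ramp_slope_def)
qed

lemma antimono_ramp_mixture: "antimono (ramp_mixture \<beta> f)"
proof (rule antimonoI)
  fix x z :: real assume "x \<le> z"
  have "f y * ramp \<beta> y z \<le> f y * ramp \<beta> y x" for y
    using f_neg[of y] f_nonneg[of y] antimonoD[OF antimono_ramp[OF \<beta>] \<open>x \<le> z\<close>]
    by (cases "y < 0") (auto intro: mult_left_mono)
  then show "ramp_mixture \<beta> f z \<le> ramp_mixture \<beta> f x"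
    unfolding ramp_mixture_def using antimonoD[OF antimono_ramp[OF \<beta>] \<open>x \<le> z\<close>]
    by (intro add_mono integral_mono integrable_mixture) auto
qed

lemma ramp_mixture_pos: "0 < ramp_mixture \<beta> f x"
  unfolding ramp_mixture_def using f_nonneg ramp_nonneg
  by (intro add_pos_nonneg Bochner_Integration.integral_nonneg) (auto simp: ramp_def)

lemma slope_mixture_nonneg: "0 \<le> slope_mixture \<beta> f x"
  unfolding slope_mixture_def using f_nonneg ramp_slope_nonneg
  by (intro add_nonneg_nonneg Bochner_Integration.integral_nonneg) auto

lemma tendsto_ramp_mixture: "(ramp_mixture \<beta> f \<longlongrightarrow> 0) at_top"
proof -
  have "((\<lambda>x. \<integral>y. f y * ramp \<beta> y x \<partial>lborel) \<longlongrightarrow> (\<integral>y. 0 \<partial>(lborel :: real measure))) at_top"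
  proof (rule integral_dominated_convergence_at_top[OF _ _ f])
    have "((\<lambda>x. f y * ramp \<beta> y x) \<longlongrightarrow> 0) at_top" for y
      using f_neg[of y] tendsto_mult[OF tendsto_const tendsto_ramp[OF \<beta>], of y "f y"]
      by (cases "y < 0") auto
    then show "AE y in lborel. ((\<lambda>x. f y * ramp \<beta> y x) \<longlongrightarrow> 0) at_top"
      by simp
    have "f y * ramp \<beta> y x \<le> f y" for y x
      using f_neg[of y] f_nonneg[of y] ramp_le_1[OF \<beta>, of y x] by (cases "y < 0"; simp add: mult_left_le)
    then show "\<forall>\<^sub>F x in at_top. AE y in lborel. norm (f y * ramp \<beta> y x) \<le> f y"
      using f_nonneg ramp_nonneg by (auto intro!: always_eventually AE_I2)
  qed (auto simp: ramp_def)
  then show ?thesis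
    unfolding ramp_mixture_def using tendsto_add[OF tendsto_ramp[OF \<beta>, of 1]] by fastforce
qed

lemma ramp_mixture_le_quadratic:
  assumes "0 < \<gamma>" "\<gamma> < 1" "0 < x" "- \<gamma> * x \<le> u"
  shows "ramp_mixture \<beta> f (x + u) \<le> ramp_mixture \<beta> f x + \<beta> * slope_mixture \<beta> f x
    * (- u / x + (1 + \<beta>) * (1 - \<gamma>) powr (- \<beta> - 2) * (u / x)\<^sup>2 / 2)" (is "_ \<le> _ + _ * ?q")
proof -
  have *: "f y * ramp \<beta> y (x + u) \<le> f y * ramp \<beta> y x + \<beta> * ?q * (f y * ramp_slope \<beta> y x)" for y
    using mult_left_mono[OF ramp_le_quadratic[OF \<beta> assms(1,2) _ assms(3,4), of y] f_nonneg[of y]] f_neg[of y]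
    by (cases "y < 0") (simp_all add: algebra_simps)
  have "(\<integral>y. f y * ramp \<beta> y (x + u) \<partial>lborel)
      \<le> (\<integral>y. f y * ramp \<beta> y x + \<beta> * ?q * (f y * ramp_slope \<beta> y x) \<partial>lborel)"
    by (intro integral_mono *  Bochner_Integration.integrable_add integrable_mult_right integrable_mixture)
  also have "\<dots> = (\<integral>y. f y * ramp \<beta> y x \<partial>lborel) + \<beta> * ?q * (\<integral>y. f y * ramp_slope \<beta> y x \<partial>lborel)"
    by (simp only: Bochner_Integration.integral_add integrable_mult_right integrable_mixture integral_mult_right_zero)
  finally have mix: "(\<integral>y. f y * ramp \<beta> y (x + u) \<partial>lborel)
      \<le> (\<integral>y. f y * ramp \<beta> y x \<partial>lborel) + \<beta> * ?q * (\<integral>y. f y * ramp_slope \<beta> y x \<partial>lborel)" .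
  have "a + a' \<le> b + b' + \<beta> * (s + s') * q" if "a \<le> b + \<beta> * s * q" "a' \<le> b' + \<beta> * q * s'"
    for a a' b b' s s' q :: real
    using that by (simp add: algebra_simps)
  from this[OF ramp_le_quadratic[OF \<beta> assms(1,2) zero_le_one assms(3,4)] mix] show ?thesis
    unfolding ramp_mixture_def slope_mixture_def .
qed

text \<open>
  Only \<open>y\<close> between \<open>x / 2\<close> and \<open>x\<close> are counted: there \<open>(y / x) powr \<beta>\<close> is at least
  \<open>2 powr - \<beta>\<close>.
\<close>

lemma slope_mixture_ge:
  assumes "0 < x" "0 \<le> c" "\<And>y. 0 \<le> y \<Longrightarrow> y < x \<Longrightarrow> c \<le> f y"
  shows "c * x * 2 powr (- \<beta> - 1) \<le> slope_mixture \<beta> f x"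
proof -
  have "c * 2 powr - \<beta> * indicator {x / 2..<x} y \<le> f y * ramp_slope \<beta> y x" for y
  proof (cases "y \<in> {x / 2..<x}")
    case True
    have "(1 / 2 :: real) powr \<beta> \<le> (y / x) powr \<beta>"
      using True assms \<beta> by (intro powr_mono2) (auto simp: field_simps)
    then have "c * (1 / 2) powr \<beta> \<le> f y * (y / x) powr \<beta>"
      using True assms f_nonneg by (intro mult_mono) auto
    moreover have "(1 / 2 :: real) powr \<beta> = 2 powr - \<beta>"
      by (simp add: powr_divide powr_minus_divide)
    ultimately show ?thesis
      using True by (simp add: ramp_slope_def)
  qed (use f_nonneg ramp_slope_nonneg in simp)
  then have "(\<integral>y. c * 2 powr - \<beta> * indicator {x / 2..<x} y \<partial>lborel) \<le> (\<integral>y. f y * ramp_slope \<beta> y x \<partial>lborel)"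
    using assms by (intro integral_mono integrable_mixture integrable_mult_right) (auto simp: integrable_indicator_iff)
  moreover have "c * x * 2 powr (- \<beta> - 1) = (\<integral>y. c * 2 powr - \<beta> * indicator {x / 2..<x} y \<partial>lborel)"
    using assms by (simp add: powr_diff)
  ultimately show ?thesis
    using ramp_slope_nonneg[of \<beta> 1 x] unfolding slope_mixture_def by linarith
qed

text \<open>
  The quadratic bound is integrated over all jumps. On the large negative ones it may fail, but
  its quadratic part is nonnegative there, so adding \<open>W 0\<close>, an upper bound of \<open>W\<close> on the state
  space, restores it.
\<close>

lemma integral_ramp_mixture_le:
  fixes N :: "real measure"
  assumes "prob_space N" and sets_N: "sets N = sets nonneg_borel"
    and int2: "integrable N (\<lambda>z. (z - x)\<^sup>2)"
    and "0 < \<gamma>" "\<gamma> < 1" "0 < x"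
  shows "(\<integral>z. ramp_mixture \<beta> f z \<partial>N) \<le> ramp_mixture \<beta> f x
    + \<beta> * slope_mixture \<beta> f x * (- (\<integral>z. z - x \<partial>N) / x
       + (1 + \<beta>) * (1 - \<gamma>) powr (- \<beta> - 2) * (\<integral>z. (z - x)\<^sup>2 \<partial>N) / (2 * x\<^sup>2))
    + ramp_mixture \<beta> f 0 * measure N {z \<in> space N. z - x \<le> - \<gamma> * x}"
    and "integrable N (ramp_mixture \<beta> f)"
proof -
  interpret N: prob_space N by fact
  define W where "W = ramp_mixture \<beta> f"
  define s where "s = \<beta> * slope_mixture \<beta> f x"
  define C where "C = (1 + \<beta>) * (1 - \<gamma>) powr (- \<beta> - 2)"
  have s: "0 \<le> s" and C: "0 \<le> C"
    using \<beta> slope_mixture_nonneg by (auto simp: s_def C_def)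
  have sp: "space N = {0..}"
    using sets_eq_imp_space_eq[OF sets_N] by simp
  have id_N: "g \<in> borel_measurable N" if "g \<in> borel_measurable borel" for g :: "real \<Rightarrow> real"
    using that measurable_restrict_space1 by (subst measurable_cong_sets[OF sets_N refl]) blast
  have W_borel: "W \<in> borel_measurable borel"
    unfolding W_def using antimono_ramp_mixture by (rule borel_measurable_antimono)
  have W_bounds: "0 < W z" "z \<in> space N \<Longrightarrow> W z \<le> W 0" for z
    using ramp_mixture_pos antimono_ramp_mixture by (auto simp: W_def sp antimono_def)
  show int_W: "integrable N (ramp_mixture \<beta> f)"
    unfolding W_def[symmetric]
  proof (rule N.integrable_const_bound)
    show "W \<in> borel_measurable N"
      using W_borel by (rule id_N)
    show "AE z in N. norm (W z) \<le> W 0"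
    proof (rule AE_I2)
      fix z assume "z \<in> space N"
      from W_bounds(2)[OF this] W_bounds(1)[of z] show "norm (W z) \<le> W 0"
        by simp
    qed
  qed
  have diff_N: "(\<lambda>z. z - x) \<in> borel_measurable N"
    by (rule id_N) measurable
  then have int1: "integrable N (\<lambda>z. z - x)"
    using int2 by (rule N.square_integrable_imp_integrable)
  let ?L = "{z \<in> space N. z - x \<le> - \<gamma> * x}"
  from diff_N have L: "?L \<in> sets N"
    unfolding borel_measurable_iff_le by blast
  have int_L: "integrable N (indicator ?L :: real \<Rightarrow> real)"
    by (intro integrable_real_indicator L) (simp add: less_top[symmetric])
  have split: "s * (- u / x + C * v / w) = (- s / x) * u + (s * C / w) * v" for u v w :: real
    by (simp add: algebra_simps)
  let ?b = "\<lambda>z. W x + (- s / x) * (z - x) + (s * C / (2 * x\<^sup>2)) * (z - x)\<^sup>2 + W 0 * indicator ?L z"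
  have "W z \<le> ?b z" if "z \<in> space N" for z
  proof (cases "z \<in> ?L")
    case True
    then have "z - x \<le> 0"
      using mult_pos_pos[OF \<open>0 < \<gamma>\<close> \<open>0 < x\<close>] by auto
    then have "0 \<le> s * (- (z - x) / x + C * (z - x)\<^sup>2 / (2 * x\<^sup>2))"
      using s C \<open>0 < x\<close> by (intro mult_nonneg_nonneg add_nonneg_nonneg) auto
    moreover have "indicator ?L z = (1 :: real)"
      using True by simp
    ultimately show ?thesis
      using W_bounds(1)[of x] W_bounds(2)[OF that] unfolding split by simp
  next
    case False
    then have "- \<gamma> * x \<le> z - x"
      using that by auto
    from ramp_mixture_le_quadratic[OF assms(4-6) this]
    have "W z \<le> W x + s * (- (z - x) / x + C * (z - x)\<^sup>2 / (2 * x\<^sup>2))"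
      by (simp add: W_def s_def C_def power_divide ac_simps)
    then show ?thesis
      using False unfolding split by simp
  qed
  then have "(\<integral>z. W z \<partial>N) \<le> (\<integral>z. ?b z \<partial>N)"
    by (intro integral_mono int_W[folded W_def] Bochner_Integration.integrable_add integrable_mult_right
        int1 int2 int_L integrable_const) auto
  also have "\<dots> = W x + (- s / x) * (\<integral>z. z - x \<partial>N) + (s * C / (2 * x\<^sup>2)) * (\<integral>z. (z - x)\<^sup>2 \<partial>N)
    + W 0 * measure N ?L"
  proof -
    have "(\<integral>z. a + b * g z + c * h z + d * k z \<partial>N)
        = a + b * (\<integral>z. g z \<partial>N) + c * (\<integral>z. h z \<partial>N) + d * (\<integral>z. k z \<partial>N)"
      if "integrable N g" "integrable N h" "integrable N k" for a b c d and g h k :: "real \<Rightarrow> real"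
      using that by (simp add: N.prob_space)
    from this[OF int1 int2 int_L, of "W x" "- s / x" "s * C / (2 * x\<^sup>2)" "W 0"] L show ?thesis
      by simp
  qed
  also have "\<dots> = W x + s * (- (\<integral>z. z - x \<partial>N) / x + C * (\<integral>z. (z - x)\<^sup>2 \<partial>N) / (2 * x\<^sup>2)) + W 0 * measure N ?L"
    unfolding split by simp
  finally show "(\<integral>z. ramp_mixture \<beta> f z \<partial>N) \<le> ramp_mixture \<beta> f x
    + \<beta> * slope_mixture \<beta> f x * (- (\<integral>z. z - x \<partial>N) / x
       + (1 + \<beta>) * (1 - \<gamma>) powr (- \<beta> - 2) * (\<integral>z. (z - x)\<^sup>2 \<partial>N) / (2 * x\<^sup>2))
    + ramp_mixture \<beta> f 0 * measure N ?L"
    by (simp add: W_def s_def C_def)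
qed

end

section \<open>Transience of the chain\<close>

text \<open>
  A negative value at \<open>x\<close> would bound the function away from zero on \<open>[x, \<infinity>)\<close>.
\<close>

lemma antimono_integrable_nonneg:
  fixes p :: "real \<Rightarrow> real"
  assumes anti: "antimono_on {0..} p" and int: "set_integrable lborel {0..} p" and "0 \<le> x"
  shows "0 \<le> p x"
proof (rule ccontr)
  assume "\<not> 0 \<le> p x"
  define I where "I = (\<integral>y. norm (indicator {0..} y *\<^sub>R p y) \<partial>lborel)"
  have "n * - p x \<le> I" for n :: nat
  proof -
    have "- p x * indicator {x..x + n} y \<le> norm (indicator {0..} y *\<^sub>R p y)" for y
      using \<open>0 \<le> x\<close> \<open>\<not> 0 \<le> p x\<close> monotone_onD[OF anti, of x y] by (auto simp: indicator_def)
    then have "(\<integral>y. - p x * indicator {x..x + n} y \<partial>lborel) \<le> I"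
      unfolding I_def using int
      by (intro integral_mono integrable_mult_right integrable_norm)
        (auto simp: set_integrable_def integrable_indicator_iff)
    then show ?thesis
      by (simp add: mult.commute)
  qed
  moreover obtain n :: nat where "I < n * - p x"
    using reals_Archimedean3[of "- p x"] \<open>\<not> 0 \<le> p x\<close> by auto
  ultimately show False
    by (meson not_le)
qed

text \<open>
  One step of the chain from \<open>x\<close>, with \<open>q\<close> standing for \<open>p x\<close> and \<open>A\<close> for \<open>1 + \<epsilon>\<close>. The
  constant in the last hypothesis is the one that the drift term produces once \<open>slope_mixture \<beta> f x\<close>
  is replaced by its lower bound.
\<close>

lemma ramp_mixture_superharmonic:
  fixes N :: "real measure"
  assumes \<beta>: "0 < \<beta>" and f: "integrable lborel f" "\<And>y. 0 \<le> f y" "\<And>y. y < 0 \<Longrightarrow> f y = 0"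
    and N: "prob_space N" "sets N = sets nonneg_borel" "integrable N (\<lambda>z. (z - x)\<^sup>2)"
    and \<gamma>: "0 < \<gamma>" "\<gamma> < 1" and x: "0 < x"
    and C: "C = (1 + \<beta>) * (1 - \<gamma>) powr (- \<beta> - 2)" "C \<le> A"
    and q: "0 \<le> q" "\<And>y. 0 \<le> y \<Longrightarrow> y < x \<Longrightarrow> q \<le> f y"
    and drift: "A * (\<integral>z. (z - x)\<^sup>2 \<partial>N) / (2 * x) \<le> (\<integral>z. z - x \<partial>N)"
    and left: "ramp_mixture \<beta> f 0 * measure N {z \<in> space N. z - x \<le> - \<gamma> * x}
      \<le> \<beta> * 2 powr (- \<beta> - 1) * (A - C) / 2 * ((\<integral>z. (z - x)\<^sup>2 \<partial>N) / x * q)"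
  shows "(\<integral>\<^sup>+z. ramp_mixture \<beta> f z \<partial>N) \<le> ramp_mixture \<beta> f x"
proof -
  define m1 m2 where "m1 = (\<integral>z. z - x \<partial>N)" and "m2 = (\<integral>z. (z - x)\<^sup>2 \<partial>N)"
  define S where "S = slope_mixture \<beta> f x"
  have "0 \<le> m2"
    unfolding m2_def by (rule Bochner_Integration.integral_nonneg) simp
  define d where "d = (A - C) * m2 / (2 * x\<^sup>2)"
  have "0 \<le> d"
    using \<open>0 \<le> m2\<close> C by (simp add: d_def)
  have "- m1 / x + C * m2 / (2 * x\<^sup>2) \<le> - d"
    using drift x unfolding m1_def[symmetric] m2_def[symmetric] d_def
    by (simp add: field_simps power2_eq_square)
  then have "\<beta> * S * (- m1 / x + C * m2 / (2 * x\<^sup>2)) \<le> \<beta> * S * - d"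
    using \<beta> slope_mixture_nonneg[OF \<beta> f] by (intro mult_left_mono) (auto simp: S_def)
  moreover have "q * x * 2 powr (- \<beta> - 1) \<le> S"
    unfolding S_def by (rule slope_mixture_ge[OF \<beta> f x q])
  then have "\<beta> * (q * x * 2 powr (- \<beta> - 1)) * d \<le> \<beta> * S * d"
    using \<beta> \<open>0 \<le> d\<close> by (intro mult_left_mono mult_right_mono) auto
  moreover have "\<beta> * (q * x * 2 powr (- \<beta> - 1)) * d = \<beta> * 2 powr (- \<beta> - 1) * (A - C) / 2 * (m2 / x * q)"
    using x by (simp add: d_def power2_eq_square)
  ultimately have "(\<integral>z. ramp_mixture \<beta> f z \<partial>N) \<le> ramp_mixture \<beta> f x"
    using integral_ramp_mixture_le(1)[OF \<beta> f N \<gamma> x] left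
    unfolding m1_def[symmetric] m2_def[symmetric] S_def[symmetric] C(1)[symmetric] by linarith
  moreover have "(\<integral>\<^sup>+z. ramp_mixture \<beta> f z \<partial>N) = (\<integral>z. ramp_mixture \<beta> f z \<partial>N)"
    using less_imp_le[OF ramp_mixture_pos[OF \<beta> f]]
    by (intro nn_integral_eq_integral integral_ramp_mixture_le(2)[OF \<beta> f N \<gamma> x]) auto
  ultimately show ?thesis
    by (simp add: ennreal_leI)
qed

theorem theorem3:
  fixes M :: "'w measure"
    and K :: "real \<Rightarrow> real measure"
    and X :: "nat \<Rightarrow> 'w \<Rightarrow> real"
    and p :: "real \<Rightarrow> real"
    and x0 \<epsilon> \<gamma> :: real
  assumes "homogeneous_markov_chain M nonneg_borel K X"
    and "\<And>x. 0 \<le> x \<Longrightarrow> integrable (jump K x) (\<lambda>u. u ^ 2)"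
    and "0 < \<epsilon>"
    and "\<And>x. 0 \<le> x \<Longrightarrow> x0 \<le> x \<Longrightarrow> 2 * x * jump_moment K 1 x / jump_moment K 2 x \<ge> 1 + \<epsilon>"
    and "AE \<omega> in M. limsup (\<lambda>n. ereal (X n \<omega>)) = \<infinity>"
    and "0 < \<gamma>" and "\<gamma> < 1 - 1 / sqrt (1 + \<epsilon>)"
    and "antimono_on {0..} p"
    and "set_integrable lborel {0..} p"
    and "(\<lambda>x. measure (jump K x) {..- \<gamma> * x}) \<in> o[at_top](\<lambda>x. jump_moment K 2 x / x * p x)"
  shows "(AE \<omega> in M. filterlim (\<lambda>n. X n \<omega>) at_top sequentially) \<and> transient M X"
proof -
  interpret homogeneous_markov_chain M nonneg_borel K X by fact
  have "0 < 1 / sqrt (1 + \<epsilon>)"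
    using \<open>0 < \<epsilon>\<close> by simp
  then have "\<gamma> < 1"
    using assms(7) by linarith
  obtain \<beta> where \<beta>: "0 < \<beta>" and "(1 + \<beta>) * (1 - \<gamma>) powr (- \<beta> - 2) < 1 + \<epsilon>"
    using exists_exponent[OF assms(6,3,7)] by blast
  then obtain C where C: "C = (1 + \<beta>) * (1 - \<gamma>) powr (- \<beta> - 2)" and "C < 1 + \<epsilon>"
    by blast
  define f where "f y = indicator {0..} y * p y" for y
  have p_nonneg: "0 \<le> p y" if "0 \<le> y" for y
    using antimono_integrable_nonneg[OF assms(8,9) that] .
  have f: "integrable lborel f" "\<And>y. 0 \<le> f y" "\<And>y. y < 0 \<Longrightarrow> f y = 0"
    using assms(9) p_nonneg by (simp_all add: f_def[abs_def] set_integrable_def indicator_def)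
  define W where "W = ramp_mixture \<beta> f"
  have W_pos: "0 < W x" for x
    unfolding W_def by (rule ramp_mixture_pos[OF \<beta> f])
  have K: "prob_space (K x)" "sets (K x) = sets nonneg_borel" if "0 \<le> x" for x
    using measurable_space[OF kernel, of x] that by (auto simp: space_prob_algebra)
  have diff_K: "(\<lambda>z. z - x) \<in> borel_measurable (K x)" if "0 \<le> x" for x
    by (subst measurable_cong_sets[OF K(2)[OF that] refl]) (intro measurable_restrict_space1, measurable)
  have moments: "jump_moment K k x = (\<integral>z. (z - x) ^ k \<partial>K x)" if "0 \<le> x" for k x
    unfolding jump_moment_def jump_def by (subst integral_distr[OF diff_K[OF that]]) auto
  \<comment> \<open>With this constant, the drift absorbs the contribution of the large negative jumps.\<close>
  define c where "c = \<beta> * 2 powr (- \<beta> - 1) * (1 + \<epsilon> - C) / 2 / W 0"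
  have "0 < c"
    using \<beta> \<open>C < 1 + \<epsilon>\<close> W_pos by (simp add: c_def)
  from landau_o.smallD[OF assms(10) this] obtain x1 where
    x1: "\<And>x. x1 \<le> x \<Longrightarrow> norm (measure (jump K x) {..- \<gamma> * x}) \<le> c * norm (jump_moment K 2 x / x * p x)"
    by (auto simp: eventually_at_top_linorder)
  have "(\<integral>\<^sup>+z. W z \<partial>K x) \<le> W x" if "max x1 (max x0 1) \<le> x" for x
  proof -
    have x: "0 < x" "x1 \<le> x" "x0 \<le> x" "0 \<le> x"
      using that by auto
    define m2 where "m2 = jump_moment K 2 x"
    have "0 \<le> m2"
      unfolding m2_def moments[OF x(4)] by (rule Bochner_Integration.integral_nonneg) simp
    \<comment> \<open>With \<open>a / 0 = 0\<close>, the drift hypothesis excludes a vanishing second moment.\<close>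
    moreover have "m2 \<noteq> 0"
      using assms(4)[OF x(4,3)] \<open>0 < \<epsilon>\<close> by (auto simp: m2_def)
    ultimately have "0 < m2"
      by simp
    have int2: "integrable (K x) (\<lambda>z. (z - x)\<^sup>2)"
      using assms(2)[OF x(4)] unfolding jump_def by (subst (asm) integrable_distr_eq[OF diff_K[OF x(4)]]) auto
    have drift: "(1 + \<epsilon>) * (\<integral>z. (z - x)\<^sup>2 \<partial>K x) / (2 * x) \<le> (\<integral>z. z - x \<partial>K x)"
      using assms(4)[OF x(4,3)] \<open>0 < m2\<close> x(1) unfolding m2_def moments[OF x(4)]
      by (simp add: field_simps)
    have "measure (jump K x) {..- \<gamma> * x} = measure (K x) {z \<in> space (K x). z - x \<le> - \<gamma> * x}"
      unfolding jump_def by (subst measure_distr[OF diff_K[OF x(4)]]) (auto intro!: arg_cong[where f = "measure (K x)"])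
    then have "measure (K x) {z \<in> space (K x). z - x \<le> - \<gamma> * x} \<le> c * (m2 / x * p x)"
      using x1[OF x(2)] \<open>0 < m2\<close> x p_nonneg[OF x(4)] by (simp add: m2_def abs_mult)
    then have "W 0 * measure (K x) {z \<in> space (K x). z - x \<le> - \<gamma> * x} \<le> W 0 * (c * (m2 / x * p x))"
      using less_imp_le[OF W_pos] by (rule mult_left_mono)
    also have "\<dots> = (W 0 * c) * (m2 / x * p x)"
      by simp
    also have "W 0 * c = \<beta> * 2 powr (- \<beta> - 1) * (1 + \<epsilon> - C) / 2"
      using W_pos[of 0] by (simp add: c_def)
    finally have left: "W 0 * measure (K x) {z \<in> space (K x). z - x \<le> - \<gamma> * x}
      \<le> \<beta> * 2 powr (- \<beta> - 1) * (1 + \<epsilon> - C) / 2 * ((\<integral>z. (z - x)\<^sup>2 \<partial>K x) / x * p x)"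
      unfolding m2_def moments[OF x(4)] .
    have "p x \<le> f y" if "0 \<le> y" "y < x" for y
      using that monotone_onD[OF assms(8), of y x] by (simp add: f_def)
    then show ?thesis
      using \<open>C < 1 + \<epsilon>\<close> left unfolding W_def
      by (intro ramp_mixture_superharmonic[OF \<beta> f K[OF x(4)] int2 assms(6) \<open>\<gamma> < 1\<close> x(1) C _ p_nonneg[OF x(4)] _ drift])
        auto
  qed
  then have "AE \<omega> in M. filterlim (\<lambda>n. X n \<omega>) at_top sequentially"
    using antimono_ramp_mixture[OF \<beta> f] tendsto_ramp_mixture[OF \<beta> f] W_pos
    by (intro filterlim_at_top_of_superharmonic[where W = W and r = "max x1 (max x0 1)", OF assms(1) _ _ _ _ assms(5)])
      (auto simp: W_def)
  then show ?thesis
    using transient_of_filterlim_at_top by blast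
qed

end
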